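(* Let $\mathcal T$ be a simplicial triangulation of a bounded polyhedral domain $\Omega\subset\mathbb R^n$, let $0\le k\le n$, and suppose that for each $T\in\mathcal T$ a finite-dimensional subspace $X(T)$ of $\Lambda^k(T)$ is given such that $\operatorname{tr}_{T,f}X(T)=\operatorname{tr}_{T',f}X(T')$ whenever $T,T'\in\mathcal T$ and $f\in\Delta(T)\cap\Delta(T')$. Assume that $\{E_{f,g}\}$, $f,g\in\Delta(\mathcal T)$, $f\subseteq g$, is a consistent family of extension operators. For $f\in\Delta(\mathcal T)$ and $\mu\in\mathring X(f)$ define $E_f\mu$ piecewise by $(E_f\mu)|_T=E_{f,T}\mu$ if $T\in\mathcal T$ and $f\subseteq T$, and $(E_f\mu)|_T=0$ if $T\in\mathcal T$ and $f\nsubseteq T$. Then the space $$X(\mathcal T)=\{\omega\in L^2\Lambda^k(\Omega)\mid \omega|_T\in X(T)\ \forall T\in\mathcal T,\ \operatorname{tr}_f\omega\text{ is single-valued for all }f\in\Delta(\mathcal T)\}$$ admits the direct sum decomposition $$X(\mathcal T)=\bigoplus_{f\in\Delta(\mathcal T)}E_f\mathring X(f).$$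
   Context: A simplicial triangulation $\mathcal T$ of $\Omega$ is a finite set of (closed) $n$-simplices whose union is the closure of $\Omega$ and such that the intersection of any two is either empty or a common subsimplex of each. $\Delta(T)$ is the set of all (nonempty, closed) subsimplices (faces) of $T$ of all dimensions $0,\dots,n$, including $T$ itself; $\Delta(\mathcal T)=\bigcup_{T\in\mathcal T}\Delta(T)$. $\Lambda^k(f)$ is the space of smooth differential $k$-forms on the simplex $f$ (it is $0$ if $\dim f<k$), and $L^2\Lambda^k(\Omega)$ is the space of $L^2$ differential $k$-forms. For simplices $f\subseteq g$, the trace $\operatorname{tr}_{g,f}:\Lambda^k(g)\to\Lambda^k(f)$ is the pullback under the inclusion $f\hookrightarrow g$. For a piecewise smooth form $\omega$, $\operatorname{tr}_f\omega$ is single-valued if the forms $\operatorname{tr}_{T,f}(\omega|_T)$ coincide for all $T\in\mathcal T$ containing $f$. For $f\in\Delta(\mathcal T)$, $X(f):=\operatorname{tr}_{T,f}X(T)$ for any $T\in\mathcal T$ containing $f$ (independent of $T$ by hypothesis), and $\mathring X(f)$ is the subspace of those $\omega\in X(f)$ whose trace on the boundary $\partial f$ (i.e. on every proper face of $f$) vanishes. An extension operator $E_{f,g}:X(f)\to X(g)$, $f\subseteq g$, is a linear right inverse of $\operatorname{tr}_{g,f}:X(g)\to X(f)$. A family of extension operators $E_{f,g}$, defined for all $f,g\in\Delta(\mathcal T)$ with $f\subseteq g$, is consistent if $$\operatorname{tr}_{h,g}E_{f,h}=E_{f\cap g,g}\operatorname{tr}_{f,f\cap g}\quad\text{for all }f,g,h\in\Delta(\mathcal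 T)\text{ with }f,g\subseteq h,$$ where the right-hand side is understood to be $0$ if $f\cap g=\emptyset$. Under these assumptions $E_f\mu$ belongs to $X(\mathcal T)$ for every $\mu\in\mathring X(f)$. *)

theory Defs
  imports "HOL-Analysis.Analysis" "HOL-Library.Function_Algebras"
begin

section \<open>Real vector spaces of functions\<close>

instantiation "fun" :: (type, real_vector) real_vector
begin

definition scaleR_fun :: "real \<Rightarrow> ('a \<Rightarrow> 'b) \<Rightarrow> 'a \<Rightarrow> 'b"
  where "scaleR_fun c f = (\<lambda>x. c *\<^sub>R f x)"

instance
  by standard (auto simp: scaleR_fun_def fun_eq_iff scaleR_add_right scaleR_add_left)

end

definition lin_on :: "'v::real_vector set \<Rightarrow> ('v \<Rightarrow> 'w::real_vector) \<Rightarrow> bool"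
  where "lin_on S L \<longleftrightarrow>
    (\<forall>u\<in>S. \<forall>v\<in>S. L (u + v) = L u + L v) \<and> (\<forall>c. \<forall>u\<in>S. L (c *\<^sub>R u) = c *\<^sub>R L u)"

definition finite_dim_subspace :: "'v::real_vector set \<Rightarrow> bool"
  where "finite_dim_subspace S \<longleftrightarrow> subspace S \<and> (\<exists>B. finite B \<and> S = span B)"

text \<open>\<open>V\<close> is the internal direct sum of the subspaces \<open>U i\<close>; meant for finite \<open>I\<close>.\<close>
definition direct_sum_of :: "'v::real_vector set \<Rightarrow> 'i set \<Rightarrow> ('i \<Rightarrow> 'v set) \<Rightarrow> bool"
  where "direct_sum_of V I U \<longleftrightarrow>
    (\<forall>i\<in>I. subspace (U i)) \<and>
    V = {\<Sum>i\<in>I. w i | w. \<forall>i\<in>I. w i \<in> U i} \<and>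
    (\<forall>w. (\<forall>i\<in>I. w i \<in> U i) \<and> (\<Sum>i\<in>I. w i) = 0 \<longrightarrow> (\<forall>i\<in>I. w i = 0))"


section \<open>Polyhedral domains and their triangulations\<close>

text \<open>Only flatness of the boundary is required: no Lipschitz condition, and interior slits are
  allowed. The polytopes have dimension less than \<open>n\<close> because \<open>frontier \<Omega>\<close> has empty interior.\<close>
definition polyhedral_domain :: "'a::euclidean_space set \<Rightarrow> bool"
  where "polyhedral_domain \<Omega> \<longleftrightarrow>
    open \<Omega> \<and> connected \<Omega> \<and> \<Omega> \<noteq> {} \<and>
    (\<exists>\<P>. finite \<P> \<and> (\<forall>P\<in>\<P>. polytope P) \<and> frontier \<Omega> = \<Union>\<P>)"

definition triangulates :: "'a::euclidean_space set set \<Rightarrow> 'a set \<Rightarrow> bool"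
  where "triangulates \<T> \<Omega> \<longleftrightarrow>
    triangulation \<T> \<and> (\<forall>T\<in>\<T>. int DIM('a) simplex T) \<and> \<Union>\<T> = closure \<Omega>"

definition faces :: "'a::euclidean_space set \<Rightarrow> 'a set set"
  where "faces T = {f. f face_of T \<and> f \<noteq> {}}"

definition all_faces :: "'a::euclidean_space set set \<Rightarrow> 'a set set"
  where "all_faces \<T> = (\<Union>T\<in>\<T>. faces T)"


section \<open>Smooth differential forms on simplices\<close>

text \<open>For open \<open>U\<close>: \<open>u\<close> is \<open>m\<close> times continuously differentiable on \<open>U\<close>.\<close>
primrec Cm_on :: "nat \<Rightarrow> 'a::euclidean_space set \<Rightarrow> ('a \<Rightarrow> real) \<Rightarrow> bool"
  where
    "Cm_on 0 U u \<longleftrightarrow> continuous_on U u"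
  | "Cm_on (Suc m) U u \<longleftrightarrow>
       (\<forall>x\<in>U. u differentiable (at x)) \<and>
       (\<forall>v. Cm_on m U (\<lambda>x. frechet_derivative u (at x) v))"

text \<open>Smoothness on a closed simplex (of any dimension) is smoothness up to the boundary:
  the function extends to a \<open>C\<^sup>\<infinity>\<close> function on a neighbourhood in the ambient space.\<close>
definition smooth_up_to_boundary :: "'a::euclidean_space set \<Rightarrow> ('a \<Rightarrow> real) \<Rightarrow> bool"
  where "smooth_up_to_boundary f u \<longleftrightarrow>
    (\<exists>U w. open U \<and> f \<subseteq> U \<and> (\<forall>m. Cm_on m U w) \<and> (\<forall>x\<in>f. w x = u x))"

definition tangent :: "'a::euclidean_space set \<Rightarrow> 'a set"
  where "tangent f = span {y - x | x y. x \<in> f \<and> y \<in> f}"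

text \<open>Alternating \<open>k\<close>-linear functionals on a subspace \<open>V\<close>. The \<open>k\<close> arguments are passed as a list;
  the value is \<open>0\<close> on lists which are not \<open>k\<close>-tuples in \<open>V\<close>, so that functionals on \<open>V\<close>
  that agree are equal.\<close>
definition alt_forms :: "nat \<Rightarrow> 'a::euclidean_space set \<Rightarrow> ('a list \<Rightarrow> real) set"
  where "alt_forms k V = {a.
    (\<forall>vs. \<not> (length vs = k \<and> set vs \<subseteq> V) \<longrightarrow> a vs = 0) \<and>
    (\<forall>vs i. length vs = k \<and> set vs \<subseteq> V \<and> i < k \<longrightarrow> lin_on V (\<lambda>u. a (vs[i := u]))) \<and>
    (\<forall>vs i j. length vs = k \<and> set vs \<subseteq> V \<and> i < j \<and> j < k \<and> vs ! i = vs ! j \<longrightarrow> a vs = 0)}"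

type_synonym 'a form = "'a \<Rightarrow> 'a list \<Rightarrow> real"

text \<open>The space \<open>\<Lambda>\<^sup>k(f)\<close>. A form on \<open>f\<close> takes tangent vectors of \<open>f\<close> only and is extended by \<open>0\<close>
  outside \<open>f\<close>, so that \<open>\<Lambda>\<^sup>k(f)\<close> is a linear subspace of the ambient function space.\<close>
definition forms :: "nat \<Rightarrow> 'a::euclidean_space set \<Rightarrow> 'a form set"
  where "forms k f = {\<omega>.
    (\<forall>x\<in>f. \<omega> x \<in> alt_forms k (tangent f)) \<and>
    (\<forall>x. x \<notin> f \<longrightarrow> \<omega> x = 0) \<and>
    (\<forall>vs. smooth_up_to_boundary f (\<lambda>x. \<omega> x vs))}"

text \<open>The pullback of a form on \<open>g \<supseteq> f\<close> under the inclusion \<open>f \<hookrightarrow> g\<close>, whose differential is the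
  inclusion of tangent spaces. It depends on \<open>g\<close> only through the argument.\<close>
definition tr :: "'a::euclidean_space set \<Rightarrow> 'a form \<Rightarrow> 'a form"
  where "tr f \<omega> = (\<lambda>x vs. if x \<in> f \<and> set vs \<subseteq> tangent f then \<omega> x vs else 0)"


section \<open>\<open>L\<^sup>2\<close> differential forms\<close>

definition ae_eq :: "'a::euclidean_space form \<Rightarrow> 'a form \<Rightarrow> bool"
  where "ae_eq \<omega> \<eta> \<longleftrightarrow> (AE x in lebesgue. \<omega> x = \<eta> x)"

quotient_type (overloaded) 'a aeform = "'a::euclidean_space form" / ae_eq
proof (rule equivpI)
  show "reflp (ae_eq :: 'a form \<Rightarrow> _)"
    by (simp add: reflp_def ae_eq_def)
  show "symp (ae_eq :: 'a form \<Rightarrow> _)"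
    unfolding symp_def ae_eq_def by (auto elim: eventually_mono)
  show "transp (ae_eq :: 'a form \<Rightarrow> _)"
    unfolding transp_def ae_eq_def
  proof (intro allI impI)
    fix u v w :: "'a form"
    assume "AE x in lebesgue. u x = v x" "AE x in lebesgue. v x = w x"
    then show "AE x in lebesgue. u x = w x" by eventually_elim simp
  qed
qed

instantiation aeform :: (euclidean_space) real_vector
begin

lift_definition zero_aeform :: "'a aeform" is "0 :: 'a form" .

lift_definition plus_aeform :: "'a aeform \<Rightarrow> 'a aeform \<Rightarrow> 'a aeform"
  is "(+) :: 'a form \<Rightarrow> 'a form \<Rightarrow> 'a form"
  unfolding ae_eq_def by (erule (1) eventually_elim2) simp

lift_definition minus_aeform :: "'a aeform \<Rightarrow> 'a aeform \<Rightarrow> 'a aeform"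
  is "(-) :: 'a form \<Rightarrow> 'a form \<Rightarrow> 'a form"
  unfolding ae_eq_def by (erule (1) eventually_elim2) simp

lift_definition uminus_aeform :: "'a aeform \<Rightarrow> 'a aeform"
  is "uminus :: 'a form \<Rightarrow> 'a form"
  unfolding ae_eq_def by (erule eventually_mono) simp

lift_definition scaleR_aeform :: "real \<Rightarrow> 'a aeform \<Rightarrow> 'a aeform"
  is "scaleR :: real \<Rightarrow> 'a form \<Rightarrow> 'a form"
  unfolding ae_eq_def by (erule eventually_mono) (simp add: scaleR_fun_def)

instance
  by standard
    (transfer, simp add: ae_eq_def fun_eq_iff algebra_simps)+

end

text \<open>\<open>L\<^sup>2\<Lambda>\<^sup>k(\<Omega>)\<close>: classes of forms with square integrable coefficients, represented by forms on the
  ambient space that vanish outside \<open>\<Omega>\<close>.\<close>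
definition L2_forms :: "nat \<Rightarrow> 'a::euclidean_space set \<Rightarrow> 'a aeform set"
  where "L2_forms k \<Omega> = abs_aeform ` {\<omega>.
    (\<forall>x\<in>\<Omega>. \<omega> x \<in> alt_forms k UNIV) \<and>
    (\<forall>x. x \<notin> \<Omega> \<longrightarrow> \<omega> x = 0) \<and>
    (\<forall>vs. length vs = k \<and> set vs \<subseteq> Basis \<longrightarrow>
       (\<lambda>x. \<omega> x vs) \<in> borel_measurable lebesgue \<and> integrable lebesgue (\<lambda>x. (\<omega> x vs)\<^sup>2))}"

text \<open>\<open>restricts_to W T \<eta>\<close>: the restriction \<open>W|\<^sub>T\<close> is the class of \<open>\<eta>\<close>. For an \<open>n\<close>-simplex \<open>T\<close> at most
  one smooth \<open>\<eta>\<close> on \<open>T\<close> has this property.\<close>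
lift_definition restricts_to :: "'a::euclidean_space aeform \<Rightarrow> 'a set \<Rightarrow> 'a form \<Rightarrow> bool"
  is "\<lambda>\<omega> T \<eta>. AE x in lebesgue. x \<in> T \<longrightarrow> \<omega> x = \<eta> x"
  unfolding ae_eq_def
  by (intro ext iffI; (erule (1) eventually_elim2, simp))

text \<open>The element given by \<open>\<eta> T\<close> on each \<open>T \<in> \<T>\<close>. The interiors of the simplices of a triangulation
  are disjoint and cover its union up to a null set, so each sum has at most one term.\<close>
definition piecewise :: "'a::euclidean_space set set \<Rightarrow> ('a set \<Rightarrow> 'a form) \<Rightarrow> 'a aeform"
  where "piecewise \<T> \<eta> = abs_aeform (\<lambda>x. \<Sum>T | T \<in> \<T> \<and> x \<in> interior T. \<eta> T x)"


section \<open>Finite element spaces and extension operators\<close>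

text \<open>Throughout, \<open>X\<close> assigns a space of forms to each \<open>T \<in> \<T>\<close>.\<close>

definition trace_compatible :: "'a::euclidean_space set set \<Rightarrow> ('a set \<Rightarrow> 'a form set) \<Rightarrow> bool"
  where "trace_compatible \<T> X \<longleftrightarrow>
    (\<forall>T\<in>\<T>. \<forall>T'\<in>\<T>. \<forall>f \<in> faces T \<inter> faces T'. tr f ` X T = tr f ` X T')"

text \<open>\<open>X(f)\<close>. For a compatible family all members of the union coincide.\<close>
definition face_space ::
  "'a::euclidean_space set set \<Rightarrow> ('a set \<Rightarrow> 'a form set) \<Rightarrow> 'a set \<Rightarrow> 'a form set"
  where "face_space \<T> X f = (\<Union>T\<in>{T\<in>\<T>. f \<in> faces T}. tr f ` X T)"

definition face_space0 ::
  "'a::euclidean_space set set \<Rightarrow> ('a set \<Rightarrow> 'a form set) \<Rightarrow> 'a set \<Rightarrow> 'a form set"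
  where "face_space0 \<T> X f =
    {\<omega> \<in> face_space \<T> X f. \<forall>e \<in> faces f. e \<noteq> f \<longrightarrow> tr e \<omega> = 0}"

definition extension_family ::
  "'a::euclidean_space set set \<Rightarrow> ('a set \<Rightarrow> 'a form set) \<Rightarrow>
   ('a set \<Rightarrow> 'a set \<Rightarrow> 'a form \<Rightarrow> 'a form) \<Rightarrow> bool"
  where "extension_family \<T> X E \<longleftrightarrow>
    (\<forall>f \<in> all_faces \<T>. \<forall>g \<in> all_faces \<T>. f \<subseteq> g \<longrightarrow>
       lin_on (face_space \<T> X f) (E f g) \<and>
       (\<forall>\<mu> \<in> face_space \<T> X f. E f g \<mu> \<in> face_space \<T> X g \<and> tr f (E f g \<mu>) = \<mu>))"

definition consistent_family ::
  "'a::euclidean_space set set \<Rightarrow> ('a set \<Rightarrow> 'a form set) \<Rightarrow>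
   ('a set \<Rightarrow> 'a set \<Rightarrow> 'a form \<Rightarrow> 'a form) \<Rightarrow> bool"
  where "consistent_family \<T> X E \<longleftrightarrow>
    (\<forall>f \<in> all_faces \<T>. \<forall>g \<in> all_faces \<T>. \<forall>h \<in> all_faces \<T>. f \<subseteq> h \<and> g \<subseteq> h \<longrightarrow>
       (\<forall>\<mu> \<in> face_space \<T> X f.
          tr g (E f h \<mu>) = (if f \<inter> g = {} then 0 else E (f \<inter> g) g (tr (f \<inter> g) \<mu>))))"

definition extend ::
  "'a::euclidean_space set set \<Rightarrow> ('a set \<Rightarrow> 'a set \<Rightarrow> 'a form \<Rightarrow> 'a form) \<Rightarrow>
   'a set \<Rightarrow> 'a form \<Rightarrow> 'a aeform"
  where "extend \<T> E f \<mu> = piecewise \<T> (\<lambda>T. if f \<subseteq> T then E f T \<mu> else 0)"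

text \<open>\<open>X(\<T>)\<close>; \<open>\<eta> T\<close> is the restriction of \<open>W\<close> to \<open>T\<close>.\<close>
definition global_space ::
  "nat \<Rightarrow> 'a::euclidean_space set \<Rightarrow> 'a set set \<Rightarrow> ('a set \<Rightarrow> 'a form set) \<Rightarrow> 'a aeform set"
  where "global_space k \<Omega> \<T> X = {W \<in> L2_forms k \<Omega>. \<exists>\<eta>.
    (\<forall>T\<in>\<T>. \<eta> T \<in> X T \<and> restricts_to W T (\<eta> T)) \<and>
    (\<forall>f \<in> all_faces \<T>. \<forall>T\<in>\<T>. \<forall>T'\<in>\<T>. f \<subseteq> T \<and> f \<subseteq> T' \<longrightarrow> tr f (\<eta> T) = tr f (\<eta> T'))}"

end

theory Submission
  imports Defs
begin

text \<open>A single-valued piecewise form is determined by its traces \<open>\<tau> f\<close>, a compatible family indexed by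
  the faces. Consistency says that for \<open>\<mu>\<close> with vanishing boundary trace on \<open>f\<close>, the trace on \<open>g\<close> of
  \<open>E f h \<mu>\<close> is \<open>E f g \<mu>\<close> if \<open>f \<subseteq> g\<close> and zero otherwise, because \<open>f \<inter> g\<close> is then a proper face of \<open>f\<close>.
  Hence a decomposition into extensions restricts on every face \<open>f\<close> to
  \<open>\<tau> f = (\<Sum>g \<subset> f. E g f (\<mu> g)) + \<mu> f\<close>. This triangular system determines \<open>\<mu>\<close> by recursion over strict
  inclusion of faces, and the \<open>\<mu> f\<close> so defined has vanishing boundary trace. Passing between classes
  modulo null sets and families of forms uses that a continuous form vanishing almost everywhere on a
  full-dimensional simplex is zero.\<close>

section \<open>Traces\<close>

lemma sum_fun_apply: "(\<Sum>i\<in>A. f i) x = (\<Sum>i\<in>A. f i x)"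
  by (induction A rule: infinite_finite_induct) auto

lemma lin_on_zero:
  assumes "lin_on S L" "subspace S"
  shows "L 0 = 0"
proof -
  have "L (0 *\<^sub>R 0) = 0 *\<^sub>R L 0"
    using assms unfolding lin_on_def by (blast intro: subspace_0)
  then show ?thesis by simp
qed

lemma tangent_mono: "e \<subseteq> f \<Longrightarrow> tangent e \<subseteq> tangent f"
  unfolding tangent_def by (rule span_mono) blast

text \<open>A ball around an interior point contains a short segment in every direction
  \<open>v\<close>, so a multiple of \<open>v\<close> is a difference of two points of
  \<open>T\<close>. Forms on a cell thus take arbitrary vectors as arguments, as
  \<open>L2_forms\<close> demands.\<close>

lemma tangent_eq_UNIV:
  fixes T :: "'a::euclidean_space set"
  assumes "interior T \<noteq> {}"
  shows "tangent T = UNIV"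
proof -
  obtain x where "x \<in> interior T"
    using assms by blast
  then obtain r where r: "r > 0" "ball x r \<subseteq> T"
    unfolding mem_interior by blast
  have "v \<in> tangent T" for v :: 'a
  proof (cases "v = 0")
    case True
    then show ?thesis by (simp add: tangent_def span_zero)
  next
    case False
    define c where "c = r / (2 * norm v)"
    have c: "c > 0" "norm (c *\<^sub>R v) < r"
      using False r by (auto simp: c_def)
    have "x + c *\<^sub>R v \<in> T" "x \<in> T"
      using r c by (auto intro!: subsetD[OF r(2)] simp: dist_norm)
    then have "(x + c *\<^sub>R v) - x \<in> tangent T"
      unfolding tangent_def by (intro span_base) blast
    then have "c *\<^sub>R v \<in> tangent T"
      by simp
    then have "(1 / c) *\<^sub>R (c *\<^sub>R v) \<in> tangent T"
      unfolding tangent_def by (rule span_scale)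
    then show ?thesis using c by simp
  qed
  then show ?thesis by blast
qed

lemma linear_tr: "linear (tr f)"
  by (rule linearI) (auto simp: tr_def fun_eq_iff scaleR_fun_def)

lemma tr_tr: "e \<subseteq> f \<Longrightarrow> tr e (tr f \<omega>) = tr e \<omega>"
  using tangent_mono[of e f] by (auto simp: tr_def fun_eq_iff)

text \<open>The truncation in \<open>tr\<close> changes nothing: a form on \<open>f\<close> already
  vanishes off \<open>f\<close> and on lists with a vector outside \<open>tangent f\<close>.\<close>

lemma tr_forms:
  assumes "\<omega> \<in> forms k f"
  shows "tr f \<omega> = \<omega>"
proof (intro ext)
  fix x vs
  show "tr f \<omega> x vs = \<omega> x vs"
    using assms by (cases "x \<in> f") (auto simp: tr_def forms_def alt_forms_def)
qed

lemma forms_continuous_on: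
  assumes "\<omega> \<in> forms k f"
  shows "continuous_on f (\<lambda>x. \<omega> x vs)"
proof -
  have "smooth_up_to_boundary f (\<lambda>x. \<omega> x vs)"
    using assms by (simp add: forms_def)
  then obtain U w where w: "f \<subseteq> U" "\<And>m. Cm_on m U w" "\<And>x. x \<in> f \<Longrightarrow> w x = \<omega> x vs"
    unfolding smooth_up_to_boundary_def by blast
  have "continuous_on f w"
    using w(2)[of 0] w(1) continuous_on_subset by auto
  then show ?thesis
    using w(3) by (rule continuous_on_eq)
qed

section \<open>Piecewise forms\<close>

text \<open>Linearity is in the whole family of local forms, added cell by cell; it moves sums of
  extensions inside \<open>piecewise\<close>.\<close>

lemma linear_piecewise: "linear (piecewise \<T>)"
proof (rule linearI)
  show "piecewise \<T> (\<eta> + \<theta>) = piecewise \<T> \<eta> + piecewise \<T> \<theta>" for \<eta> \<theta>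
    unfolding piecewise_def plus_aeform.abs_eq
    by (rule arg_cong[where f = abs_aeform]) (auto simp: fun_eq_iff sum.distrib)
  show "piecewise \<T> (c *\<^sub>R \<eta>) = c *\<^sub>R piecewise \<T> \<eta>" for c \<eta>
    unfolding piecewise_def scaleR_aeform.abs_eq
    by (rule arg_cong[where f = abs_aeform])
      (simp add: fun_eq_iff scaleR_fun_def sum_fun_apply sum_distrib_left)
qed

lemma piecewise_cong:
  "(\<And>T. T \<in> \<T> \<Longrightarrow> \<eta> T = \<theta> T) \<Longrightarrow> piecewise \<T> \<eta> = piecewise \<T> \<theta>"
  by (simp add: piecewise_def)

text \<open>The part of the interior where \<open>u\<close> is nonzero is open and null, hence
  empty. As \<open>T\<close> is the closure of its interior, continuity carries the zero to the
  boundary.\<close>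

lemma continuous_AE_zero_imp_zero:
  fixes u :: "'a::euclidean_space \<Rightarrow> real"
  assumes "convex T" "interior T \<noteq> {}" "closed T" "continuous_on T u"
    and "AE x in lebesgue. x \<in> interior T \<longrightarrow> u x = 0" and "x \<in> T"
  shows "u x = 0"
proof -
  have "open (interior T \<inter> u -` (- {0}))"
    by (intro continuous_open_preimage continuous_on_subset[OF assms(4)] interior_subset) auto
  moreover from this have "interior T \<inter> u -` (- {0}) \<in> sets lebesgue"
    by simp
  then have "negligible (interior T \<inter> u -` (- {0}))"
    unfolding negligible_iff_null_sets
    by (subst AE_iff_null_sets) (use assms(5) in \<open>auto elim: eventually_mono\<close>)
  ultimately have "interior T \<inter> u -` (- {0}) = {}"
    using open_not_negligible by blast
  then have "u y = 0" if "y \<in> interior T" for y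
    using that by blast
  moreover have "closure (interior T) = T"
    using assms(1-3) by (metis closure_closed convex_closure_interior)
  ultimately show ?thesis
    using continuous_constant_on_closure[of "interior T" u 0 x] assms(4,6) by simp
qed

section \<open>Geometry of the triangulation\<close>

locale triangulated_domain =
  fixes \<Omega> :: "'a::euclidean_space set" and \<T> :: "'a set set"
  assumes domain: "polyhedral_domain \<Omega>" and triangulates: "triangulates \<T> \<Omega>"
begin

lemma finite_\<T>: "finite \<T>"
  using triangulates by (simp add: triangulates_def triangulation_def)

lemma simplex_cell: "T \<in> \<T> \<Longrightarrow> int DIM('a) simplex T"
  using triangulates by (simp add: triangulates_def)

lemma polytope_cell: "T \<in> \<T> \<Longrightarrow> polytope T"
  using simplex_cell simplex_imp_polytope by blast

lemma compact_cell: "T \<in> \<T> \<Longrightarrow> compact T"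
  using polytope_cell polytope_imp_compact by blast

lemma convex_cell: "T \<in> \<T> \<Longrightarrow> convex T"
  using polytope_cell polytope_imp_convex by blast

lemma interior_cell:
  assumes "T \<in> \<T>"
  shows "interior T \<noteq> {}"
proof -
  have "aff_dim T = int DIM('a)"
    using simplex_cell[OF assms] aff_dim_simplex by blast
  moreover from this have "T \<noteq> {}"
    by auto
  ultimately show ?thesis
    using rel_interior_eq_empty[OF convex_cell[OF assms]] interior_rel_interior by blast
qed

lemma cell_Int_face: "T \<in> \<T> \<Longrightarrow> T' \<in> \<T> \<Longrightarrow> T \<inter> T' face_of T"
  using triangulates by (simp add: triangulates_def triangulation_def)

text \<open>The intersection of two cells is a face of each, and a face that meets the relative
  interior of a convex set is the whole set.\<close>

lemma cell_eq_if_interior_meets: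
  assumes "T \<in> \<T>" "T' \<in> \<T>" "x \<in> interior T" "x \<in> T'"
  shows "T = T'"
proof -
  have meets: "S \<subseteq> S'" if "S \<in> \<T>" "S' \<in> \<T>" "y \<in> interior S" "y \<in> S'" for S S' y
  proof -
    have "y \<in> rel_interior S \<inter> (S \<inter> S')"
      using that interior_subset_rel_interior interior_subset by blast
    then have "S \<subseteq> S \<inter> S'"
      using subset_of_face_of[OF cell_Int_face[OF that(1,2)], of S] by blast
    then show ?thesis by blast
  qed
  have "T \<subseteq> T'" by (rule meets[OF assms])
  \<comment> \<open>After the first inclusion the same point is interior to \<open>T'\<close>, so
    the roles can be exchanged.\<close>
  then have "x \<in> interior T'"
    using assms(3) interior_mono by blast
  then have "T' \<subseteq> T"
    using meets[of T' T x] assms interior_subset by blast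
  with \<open>T \<subseteq> T'\<close> show ?thesis by blast
qed

text \<open>Only \<open>T\<close> contributes, since interiors of distinct cells are disjoint; this
  evaluates \<open>piecewise\<close> inside a cell.\<close>

lemma sum_cells_eq:
  fixes \<eta> :: "'a set \<Rightarrow> 'a \<Rightarrow> 'b::comm_monoid_add"
  assumes "T \<in> \<T>" "x \<in> interior T"
  shows "(\<Sum>T' | T' \<in> \<T> \<and> x \<in> interior T'. \<eta> T' x) = \<eta> T x"
proof -
  have "{T' \<in> \<T>. x \<in> interior T'} = {T}"
    using assms cell_eq_if_interior_meets interior_subset by blast
  then show ?thesis by simp
qed

section \<open>Faces and the inclusion order\<close>

lemma all_faces_cell: "f \<in> all_faces \<T> \<Longrightarrow> \<exists>T\<in>\<T>. f face_of T"
  by (auto simp: all_faces_def faces_def)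

lemma all_faces_nonempty: "f \<in> all_faces \<T> \<Longrightarrow> f \<noteq> {}"
  by (auto simp: all_faces_def faces_def)

lemma cell_in_all_faces: "T \<in> \<T> \<Longrightarrow> T \<in> all_faces \<T>"
  using interior_cell interior_subset convex_cell
  by (fastforce simp: all_faces_def faces_def intro: face_of_refl)

lemma finite_all_faces: "finite (all_faces \<T>)"
proof -
  have "finite (faces T)" if "T \<in> \<T>" for T
    using finite_polytope_faces[OF polytope_cell[OF that]] by (simp add: faces_def)
  then show ?thesis
    by (simp add: all_faces_def finite_\<T>)
qed

text \<open>If \<open>f\<close> is a face of \<open>T'\<close>, then it is a face of the smaller set
  \<open>T \<inter> T'\<close>, which is itself a face of \<open>T\<close>. So inclusion, which
  indexes the operators, agrees with the face relation used in \<open>face_space0\<close>.\<close>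

lemma face_of_cell:
  assumes "f \<in> all_faces \<T>" "T \<in> \<T>" "f \<subseteq> T"
  shows "f face_of T"
proof -
  obtain T' where T': "T' \<in> \<T>" "f face_of T'"
    using all_faces_cell assms by blast
  have "f face_of T \<inter> T'"
    using T'(2) assms(3) face_of_imp_subset face_of_subset by (metis Int_lower2 le_inf_iff)
  then show ?thesis
    using cell_Int_face[OF assms(2) T'(1)] face_of_trans by blast
qed

lemma face_of_face:
  assumes "e \<in> all_faces \<T>" "f \<in> all_faces \<T>" "e \<subseteq> f"
  shows "e \<in> faces f"
proof -
  obtain T where T: "T \<in> \<T>" "f face_of T"
    using all_faces_cell assms by blast
  then have "e face_of T"
    using face_of_cell assms face_of_imp_subset by (metis order_trans)
  then have "e face_of f"
    using face_of_subset[OF _ assms(3)] T(2) face_of_imp_subset by blast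
  then show ?thesis
    using all_faces_nonempty[OF assms(1)] by (simp add: faces_def)
qed

lemma faces_subset_all_faces:
  assumes "e \<in> faces f" "f \<in> all_faces \<T>"
  shows "e \<in> all_faces \<T>"
  using assms unfolding all_faces_def faces_def by (auto intro: face_of_trans)

text \<open>Guarantees that the operator \<open>E (f \<inter> g) g\<close> in the consistency
  condition belongs to the family.\<close>

lemma all_faces_Int:
  assumes "f \<in> all_faces \<T>" "g \<in> all_faces \<T>" "h \<in> all_faces \<T>"
    and "f \<subseteq> h" "g \<subseteq> h" "f \<inter> g \<noteq> {}"
  shows "f \<inter> g \<in> all_faces \<T>"
proof (rule faces_subset_all_faces)
  have "f face_of h" "g face_of h"
    using assms face_of_face by (auto simp: faces_def)
  then show "f \<inter> g \<in> faces h"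
    using assms by (simp add: faces_def face_of_Int)
qed (use assms in simp)

text \<open>The number of faces contained in \<open>f\<close> grows strictly with \<open>f\<close>,
  because \<open>f\<close> itself is counted. This is the order of the recursion for the
  components.\<close>

lemma wf_strict_faces: "wf {(g, f). g \<in> all_faces \<T> \<and> f \<in> all_faces \<T> \<and> g \<subset> f}"
proof (rule wf_subset[OF wf_measure])
  show "{(g, f). g \<in> all_faces \<T> \<and> f \<in> all_faces \<T> \<and> g \<subset> f}
      \<subseteq> Wellfounded.measure (\<lambda>f. card {e \<in> all_faces \<T>. e \<subseteq> f})"
  proof (rule subrelI)
    fix g f
    assume "(g, f) \<in> {(g, f). g \<in> all_faces \<T> \<and> f \<in> all_faces \<T> \<and> g \<subset> f}"
    then have "{e \<in> all_faces \<T>. e \<subseteq> g} \<subset> {e \<in> all_faces \<T>. e \<subseteq> f}"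
      by blast
    then show "(g, f) \<in> Wellfounded.measure (\<lambda>f. card {e \<in> all_faces \<T>. e \<subseteq> f})"
      by (simp add: psubset_card_mono finite_all_faces)
  qed
qed

section \<open>Null sets\<close>

text \<open>Cells cover the closure of \<open>\<Omega>\<close>, whereas representatives in
  \<open>L2_forms\<close> vanish off \<open>\<Omega>\<close>; the difference is a finite union of
  convex sets without interior, hence null.\<close>

lemma AE_domain: "AE x in lebesgue. x \<in> \<Omega> \<or> x \<notin> closure \<Omega>"
proof -
  obtain \<P> where \<P>: "finite \<P>" "\<And>P. P \<in> \<P> \<Longrightarrow> polytope P" "frontier \<Omega> = \<Union>\<P>" and "open \<Omega>"
    using domain by (auto simp: polyhedral_domain_def)
  \<comment> \<open>An open set that misses \<open>\<Omega>\<close> also misses its closure, which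
    contains the frontier.\<close>
  have "interior (frontier \<Omega>) = {}"
    using open_Int_closure_eq_empty[of "interior (frontier \<Omega>)" \<Omega>] interior_subset[of "frontier \<Omega>"]
      \<open>open \<Omega>\<close> by (fastforce simp: frontier_def interior_open)
  then have "negligible P" if "P \<in> \<P>" for P
    using that \<P> interior_mono[of P "frontier \<Omega>"] negligible_convex_interior[of P]
      polytope_imp_convex by blast
  then have "negligible (frontier \<Omega>)"
    using \<P> by (auto intro: negligible_Union)
  then have "AE x in lebesgue. x \<notin> frontier \<Omega>"
    by (simp add: negligible_iff_null_sets AE_not_in)
  then show ?thesis
    by eventually_elim (use \<open>open \<Omega>\<close> in \<open>auto simp: frontier_def interior_open\<close>)
qed

lemma AE_cell_interior: "AE x in lebesgue. \<forall>T\<in>\<T>. x \<in> T \<longrightarrow> x \<in> interior T"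
proof -
  have "AE x in lebesgue. x \<in> T \<longrightarrow> x \<in> interior T" if "T \<in> \<T>" for T
  proof -
    have "AE x in lebesgue. x \<notin> frontier T"
      using negligible_convex_frontier[OF convex_cell[OF that]]
      by (simp add: negligible_iff_null_sets AE_not_in)
    then show ?thesis
      by eventually_elim (use closure_subset in \<open>auto simp: frontier_def\<close>)
  qed
  then show ?thesis
    by (simp add: AE_ball_countable finite_\<T> countable_finite)
qed

lemma cells_cover: "x \<in> \<Omega> \<Longrightarrow> \<exists>T\<in>\<T>. x \<in> T"
  using triangulates closure_subset by (fastforce simp: triangulates_def)

lemma cell_subset_closure: "T \<in> \<T> \<Longrightarrow> T \<subseteq> closure \<Omega>"
  using triangulates by (auto simp: triangulates_def)

end

section \<open>Extension operators\<close>

locale extension_setting = triangulated_domain \<Omega> \<T>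
  for \<Omega> :: "'a::euclidean_space set" and \<T> :: "'a set set" +
  fixes k :: nat
    and X :: "'a set \<Rightarrow> 'a form set"
    and E :: "'a set \<Rightarrow> 'a set \<Rightarrow> 'a form \<Rightarrow> 'a form"
  assumes X_forms: "T \<in> \<T> \<Longrightarrow> X T \<subseteq> forms k T"
    and subspace_X: "T \<in> \<T> \<Longrightarrow> subspace (X T)"
    and compatible: "trace_compatible \<T> X"
    and extension: "extension_family \<T> X E"
    and consistent: "consistent_family \<T> X E"
begin

section \<open>Trace spaces on faces\<close>

abbreviation "F \<equiv> all_faces \<T>"
abbreviation "X\<^sub>F \<equiv> face_space \<T> X"
abbreviation "X\<^sub>0 \<equiv> face_space0 \<T> X"

text \<open>Trace compatibility makes all members of the union in \<open>face_space\<close> equal,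
  so any cell containing \<open>f\<close> may be used.\<close>

lemma face_space_eq:
  assumes "f \<in> F" "T \<in> \<T>" "f \<subseteq> T"
  shows "X\<^sub>F f = tr f ` X T"
proof -
  have "f \<in> faces T"
    using face_of_face cell_in_all_faces assms by blast
  then show ?thesis
    using compatible assms unfolding face_space_def trace_compatible_def by blast
qed

lemma face_space_cell:
  assumes "T \<in> \<T>"
  shows "X\<^sub>F T = X T"
proof -
  have "tr T \<omega> = \<omega>" if "\<omega> \<in> X T" for \<omega>
    using X_forms[OF assms] that tr_forms by blast
  then show ?thesis
    using face_space_eq[of T T] cell_in_all_faces[OF assms] assms by simp
qed

lemma subspace_face_space:
  assumes "f \<in> F"
  shows "subspace (X\<^sub>F f)"
proof -
  obtain T where "T \<in> \<T>" "f \<subseteq> T"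
    using all_faces_cell[OF assms] face_of_imp_subset by blast
  then show ?thesis
    using face_space_eq[OF assms] subspace_X linear_tr linear_subspace_image by metis
qed

lemma tr_face_space:
  assumes "e \<in> F" "f \<in> F" "e \<subseteq> f" "\<omega> \<in> X\<^sub>F f"
  shows "tr e \<omega> \<in> X\<^sub>F e"
proof -
  obtain T where T: "T \<in> \<T>" "f \<subseteq> T"
    using all_faces_cell[OF assms(2)] face_of_imp_subset by blast
  then have "X\<^sub>F f = tr f ` X T" "X\<^sub>F e = tr e ` X T"
    using face_space_eq assms by blast+
  then show ?thesis
    using assms by (auto simp: tr_tr)
qed

lemma tr_face_space_id: "\<omega> \<in> X\<^sub>F f \<Longrightarrow> tr f \<omega> = \<omega>"
  by (auto simp: face_space_def tr_tr)

lemma face_space0_subset: "X\<^sub>0 f \<subseteq> X\<^sub>F f"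
  by (auto simp: face_space0_def)

lemma subspace_face_space0:
  assumes "f \<in> F"
  shows "subspace (X\<^sub>0 f)"
  using subspace_face_space[OF assms]
  by (auto simp: face_space0_def subspace_def linear_0[OF linear_tr] linear_add[OF linear_tr]
      linear_cmul[OF linear_tr])

lemma lin_on_E: "f \<in> F \<Longrightarrow> g \<in> F \<Longrightarrow> f \<subseteq> g \<Longrightarrow> lin_on (X\<^sub>F f) (E f g)"
  using extension by (simp add: extension_family_def)

lemma E_mem: "f \<in> F \<Longrightarrow> g \<in> F \<Longrightarrow> f \<subseteq> g \<Longrightarrow> \<mu> \<in> X\<^sub>F f \<Longrightarrow> E f g \<mu> \<in> X\<^sub>F g"
  using extension by (simp add: extension_family_def)

lemma tr_E: "f \<in> F \<Longrightarrow> g \<in> F \<Longrightarrow> f \<subseteq> g \<Longrightarrow> \<mu> \<in> X\<^sub>F f \<Longrightarrow> tr f (E f g \<mu>) = \<mu>"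
  using extension by (simp add: extension_family_def)

text \<open>\<open>E f f \<mu>\<close> lies in \<open>X\<^sub>F f\<close>, where \<open>tr f\<close>
  is the identity, and its trace on \<open>f\<close> is \<open>\<mu>\<close>.\<close>

lemma E_self: "f \<in> F \<Longrightarrow> \<mu> \<in> X\<^sub>F f \<Longrightarrow> E f f \<mu> = \<mu>"
  by (metis E_mem order_refl tr_E tr_face_space_id)

lemma E_zero: "f \<in> F \<Longrightarrow> g \<in> F \<Longrightarrow> f \<subseteq> g \<Longrightarrow> E f g 0 = 0"
  using lin_on_E lin_on_zero subspace_face_space by blast

text \<open>All later arguments use consistency only through this identity.\<close>

lemma tr_E_face_space0:
  assumes "f \<in> F" "g \<in> F" "h \<in> F" "f \<subseteq> h" "g \<subseteq> h" "\<mu> \<in> X\<^sub>0 f"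
  shows "tr g (E f h \<mu>) = (if f \<subseteq> g then E f g \<mu> else 0)"
proof -
  have \<mu>: "\<mu> \<in> X\<^sub>F f"
    using assms(6) face_space0_subset by blast
  then have tr: "tr g (E f h \<mu>) = (if f \<inter> g = {} then 0 else E (f \<inter> g) g (tr (f \<inter> g) \<mu>))"
    using consistent assms unfolding consistent_family_def by blast
  show ?thesis
  proof (cases "f \<subseteq> g")
    case True
    then have "f \<inter> g = f" by blast
    then show ?thesis
      using tr tr_face_space_id[OF \<mu>] all_faces_nonempty[OF assms(1)] True by simp
  next
    case False
    show ?thesis
    proof (cases "f \<inter> g = {}")
      case True
      then show ?thesis using tr False by simp
    next
      case meet: False
      have "f \<inter> g \<in> F"
        using all_faces_Int[OF assms(1-5) meet] .
      moreover from this have "tr (f \<inter> g) \<mu> = 0"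
        using face_of_face[of "f \<inter> g" f] assms(1,6) False by (auto simp: face_space0_def)
      ultimately show ?thesis
        using tr meet False E_zero[of "f \<inter> g" g] assms(2) by simp
    qed
  qed
qed

section \<open>The triangular system on faces\<close>

text \<open>On a cell this is the restriction of the sum of all extensions of the
  \<open>\<mu> g\<close>. It is defined on every face so that traces keep the same form.\<close>

definition assemble :: "('a set \<Rightarrow> 'a form) \<Rightarrow> 'a set \<Rightarrow> 'a form"
  where "assemble \<mu> h = (\<Sum>g | g \<in> F \<and> g \<subseteq> h. E g h (\<mu> g))"

text \<open>Terms with \<open>g\<close> not contained in \<open>e\<close> have zero trace. The set
  \<open>A\<close> is left flexible to cover both all faces inside \<open>h\<close> and only the
  proper ones.\<close>

lemma tr_sum_E:
  assumes "e \<in> F" "h \<in> F" "e \<subseteq> h"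
    and A: "A \<subseteq> {g \<in> F. g \<subseteq> h}" "{g \<in> F. g \<subseteq> e} \<subseteq> A"
    and \<mu>: "\<And>g. g \<in> A \<Longrightarrow> \<mu> g \<in> X\<^sub>0 g"
  shows "tr e (\<Sum>g\<in>A. E g h (\<mu> g)) = assemble \<mu> e"
proof -
  have "finite A"
    using A(1) finite_all_faces by (auto intro: finite_subset)
  have "tr e (\<Sum>g\<in>A. E g h (\<mu> g)) = (\<Sum>g\<in>A. tr e (E g h (\<mu> g)))"
    by (rule linear_sum[OF linear_tr])
  also have "\<dots> = (\<Sum>g\<in>A. if g \<subseteq> e then E g e (\<mu> g) else 0)"
    using A(1) assms by (intro sum.cong refl tr_E_face_space0) auto
  also have "\<dots> = assemble \<mu> e"
    unfolding assemble_def using \<open>finite A\<close> A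
    by (intro sum.mono_neutral_cong_right) auto
  finally show ?thesis .
qed

lemma tr_assemble:
  assumes "e \<in> F" "h \<in> F" "e \<subseteq> h" "\<And>g. g \<in> F \<Longrightarrow> \<mu> g \<in> X\<^sub>0 g"
  shows "tr e (assemble \<mu> h) = assemble \<mu> e"
  unfolding assemble_def[of \<mu> h] using assms by (intro tr_sum_E) auto

lemma assemble_mem:
  assumes "h \<in> F" "\<And>g. g \<in> F \<Longrightarrow> \<mu> g \<in> X\<^sub>0 g"
  shows "assemble \<mu> h \<in> X\<^sub>F h"
  unfolding assemble_def using assms face_space0_subset
  by (intro subspace_sum subspace_face_space E_mem) auto

text \<open>By \<open>E_self\<close> the diagonal term is \<open>\<mu> f\<close> itself, so the
  system is triangular with identity diagonal.\<close>

lemma assemble_split: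
  assumes "f \<in> F" "\<mu> f \<in> X\<^sub>F f"
  shows "assemble \<mu> f = (\<Sum>g | g \<in> F \<and> g \<subset> f. E g f (\<mu> g)) + \<mu> f"
proof -
  have "{g \<in> F. g \<subseteq> f} = insert f {g \<in> F. g \<subset> f}"
    using assms by blast
  then show ?thesis
    using assms finite_all_faces by (simp add: assemble_def E_self add.commute)
qed

lemma ex_assemble:
  assumes \<tau>: "\<And>f. f \<in> F \<Longrightarrow> \<tau> f \<in> X\<^sub>F f"
    and tr_\<tau>: "\<And>e f. e \<in> F \<Longrightarrow> f \<in> F \<Longrightarrow> e \<subseteq> f \<Longrightarrow> tr e (\<tau> f) = \<tau> e"
  shows "\<exists>\<mu>. \<forall>f\<in>F. \<mu> f \<in> X\<^sub>0 f \<and> assemble \<mu> f = \<tau> f"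
proof -
  define R where "R = {(g, f). g \<in> F \<and> f \<in> F \<and> g \<subset> f}"
  \<comment> \<open>\<open>r\<close> is a candidate for \<open>\<mu> f\<close>, given the values of
    \<open>\<mu>\<close> on strictly smaller faces; sets that are not faces are
    unconstrained.\<close>
  define P where "P \<mu> f r \<longleftrightarrow>
    (f \<in> F \<longrightarrow> r \<in> X\<^sub>0 f \<and> \<tau> f = (\<Sum>g | g \<in> F \<and> g \<subset> f. E g f (\<mu> g)) + r)"
    for \<mu> :: "'a set \<Rightarrow> 'a form" and f r
  have "\<exists>\<mu>. \<forall>f. P \<mu> f (\<mu> f)"
  proof (rule dependent_wf_choice)
    show "wf R"
      unfolding R_def by (rule wf_strict_faces)
  next
    fix \<mu> \<nu> :: "'a set \<Rightarrow> 'a form" and f r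
    assume "\<And>g. (g, f) \<in> R \<Longrightarrow> \<mu> g = \<nu> g"
    then have "(\<Sum>g | g \<in> F \<and> g \<subset> f. E g f (\<mu> g)) = (\<Sum>g | g \<in> F \<and> g \<subset> f. E g f (\<nu> g))"
      if "f \<in> F"
      using that by (intro sum.cong) (auto simp: R_def)
    then show "P \<mu> f r = P \<nu> f r"
      by (auto simp: P_def)
  next
    fix f and \<mu> :: "'a set \<Rightarrow> 'a form"
    assume IH: "\<And>g. (g, f) \<in> R \<Longrightarrow> P \<mu> g (\<mu> g)"
    show "\<exists>r. P \<mu> f r"
    proof (cases "f \<in> F")
      case True
      \<comment> \<open>The part of \<open>\<tau> f\<close> not accounted for by extensions from
        proper faces.\<close>
      define r where "r = \<tau> f - (\<Sum>g | g \<in> F \<and> g \<subset> f. E g f (\<mu> g))"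
      have \<mu>: "\<mu> g \<in> X\<^sub>0 g" "\<tau> g = assemble \<mu> g" if "g \<in> F" "g \<subset> f" for g
      proof -
        have "P \<mu> g (\<mu> g)"
          using IH that True by (simp add: R_def)
        then show "\<mu> g \<in> X\<^sub>0 g" "\<tau> g = assemble \<mu> g"
          using that(1) face_space0_subset[of g] assemble_split[of g \<mu>] by (simp_all add: P_def subset_iff)
      qed
      have "r \<in> X\<^sub>F f"
        unfolding r_def using True \<mu>(1) face_space0_subset
        by (intro subspace_diff subspace_sum subspace_face_space \<tau> E_mem) auto
      \<comment> \<open>Every face inside the proper face \<open>e\<close> already occurs in the
        sum, whose trace is therefore \<open>assemble \<mu> e\<close>. By induction this is
        \<open>\<tau> e\<close>, also the trace of \<open>\<tau> f\<close>, and the two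
        cancel.\<close>
      moreover have "tr e r = 0" if e: "e \<in> faces f" "e \<noteq> f" for e
      proof -
        have "e \<in> F"
          using e(1) True by (rule faces_subset_all_faces)
        have "e \<subset> f"
          using e face_of_imp_subset[of e f] by (auto simp: faces_def)
        with \<open>e \<in> F\<close> have "tr e (\<Sum>g | g \<in> F \<and> g \<subset> f. E g f (\<mu> g)) = assemble \<mu> e" "tr e (\<tau> f) = \<tau> e"
          using True \<mu>(1) by (auto intro!: tr_sum_E tr_\<tau>)
        then show ?thesis
          using \<mu>(2)[OF \<open>e \<in> F\<close> \<open>e \<subset> f\<close>] by (simp add: r_def linear_diff[OF linear_tr])
      qed
      ultimately show ?thesis
        unfolding P_def face_space0_def by (intro exI[of _ r]) (simp add: r_def)
    qed (simp add: P_def)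
  qed
  then obtain \<mu> where "\<And>f. P \<mu> f (\<mu> f)"
    by blast
  then have "\<forall>f\<in>F. \<mu> f \<in> X\<^sub>0 f \<and> assemble \<mu> f = \<tau> f"
    using assemble_split[of _ \<mu>] face_space0_subset by (fastforce simp: P_def)
  then show ?thesis
    by blast
qed

text \<open>Induction along the triangular system: once all smaller components vanish, only the
  diagonal term \<open>\<mu> f\<close> is left.\<close>

lemma assemble_eq_zero:
  assumes \<mu>: "\<And>f. f \<in> F \<Longrightarrow> \<mu> f \<in> X\<^sub>0 f"
    and zero: "\<And>f. f \<in> F \<Longrightarrow> assemble \<mu> f = 0"
    and "f \<in> F"
  shows "\<mu> f = 0"
  using wf_strict_faces \<open>f \<in> F\<close>
proof (induction f rule: wf_induct_rule)
  case (less f)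
  have "(\<Sum>g | g \<in> F \<and> g \<subset> f. E g f (\<mu> g)) = 0"
  proof (intro sum.neutral ballI)
    fix g
    assume "g \<in> {g \<in> F. g \<subset> f}"
    then have "g \<in> F" "g \<subset> f"
      by auto
    with less have "\<mu> g = 0"
      by blast
    then show "E g f (\<mu> g) = 0"
      using less.prems \<open>g \<in> F\<close> \<open>g \<subset> f\<close> E_zero[of g f] by auto
  qed
  moreover have "\<mu> f \<in> X\<^sub>F f"
    using less.prems \<mu> face_space0_subset by blast
  ultimately show ?case
    using assemble_split[of f \<mu>] less.prems zero[of f] by simp
qed

section \<open>The global space\<close>

lemma piecewise_L2:
  assumes \<eta>: "\<And>T. T \<in> \<T> \<Longrightarrow> \<eta> T \<in> forms k T"
  shows "piecewise \<T> \<eta> \<in> L2_forms k \<Omega>"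
proof -
  \<comment> \<open>The sum is cut off outside \<open>\<Omega>\<close> because the interior of a
    cell may contain frontier points, for instance on a slit. Only a null set is affected.\<close>
  define \<omega> where "\<omega> x = (if x \<in> \<Omega> then \<Sum>T | T \<in> \<T> \<and> x \<in> interior T. \<eta> T x else 0)" for x
  have \<omega>_cell: "\<omega> x = \<eta> T x" if "x \<in> \<Omega>" "T \<in> \<T>" "x \<in> interior T" for x T
    using that sum_cells_eq[of T x \<eta>] by (simp add: \<omega>_def)
  have \<omega>_zero: "\<omega> x = 0" if "\<not> (\<exists>T\<in>\<T>. x \<in> interior T)" for x
  proof -
    have "{T \<in> \<T>. x \<in> interior T} = {}"
      using that by blast
    then show ?thesis by (simp add: \<omega>_def del: Collect_empty_eq)
  qed
  have "ae_eq (\<lambda>x. \<Sum>T | T \<in> \<T> \<and> x \<in> interior T. \<eta> T x) \<omega>"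
    unfolding ae_eq_def using AE_domain
  proof eventually_elim
    case (elim x)
    show ?case
    proof (cases "x \<in> \<Omega>")
      case False
      then have "{T \<in> \<T>. x \<in> interior T} = {}"
        using elim cell_subset_closure interior_subset by blast
      then show ?thesis
        using False by (simp add: \<omega>_def del: Collect_empty_eq)
    qed (simp add: \<omega>_def)
  qed
  then have "piecewise \<T> \<eta> = abs_aeform \<omega>"
    by (simp add: piecewise_def aeform.abs_eq_iff)
  moreover have "\<omega> x \<in> alt_forms k UNIV" if "x \<in> \<Omega>" for x
  proof (cases "\<exists>T\<in>\<T>. x \<in> interior T")
    case True
    then obtain T where T: "T \<in> \<T>" "x \<in> interior T" by blast
    then have "\<omega> x \<in> alt_forms k (tangent T)"
      using \<eta>[OF T(1)] \<omega>_cell[OF that] interior_subset by (auto simp: forms_def)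
    then show ?thesis
      using tangent_eq_UNIV interior_cell T(1) by metis
  next
    case False
    then show ?thesis
      by (simp add: \<omega>_zero alt_forms_def lin_on_def)
  qed
  moreover have "(\<lambda>x. \<omega> x vs) \<in> borel_measurable lebesgue \<and> integrable lebesgue (\<lambda>x. (\<omega> x vs)\<^sup>2)" for vs
  proof
    have "open \<Omega>"
      using domain by (simp add: polyhedral_domain_def)
    have "(\<lambda>x. indicator (\<Omega> \<inter> interior T) x *\<^sub>R \<eta> T x vs) \<in> borel_measurable borel" if "T \<in> \<T>" for T
    proof (rule borel_measurable_continuous_on_indicator)
      show "continuous_on (\<Omega> \<inter> interior T) (\<lambda>x. \<eta> T x vs)"
        using forms_continuous_on[OF \<eta>[OF that]]
        by (rule continuous_on_subset) (use interior_subset in blast)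
    qed (use \<open>open \<Omega>\<close> in simp)
    then have "(\<lambda>x. \<Sum>T\<in>\<T>. indicator (\<Omega> \<inter> interior T) x *\<^sub>R \<eta> T x vs) \<in> borel_measurable borel"
      by (rule borel_measurable_sum)
    \<comment> \<open>Indicators turn the sum over cells depending on \<open>x\<close> into one over
      all cells, which is measurable term by term.\<close>
    moreover have "\<omega> x vs = (\<Sum>T\<in>\<T>. indicator (\<Omega> \<inter> interior T) x *\<^sub>R \<eta> T x vs)" for x
      by (auto simp: \<omega>_def sum_fun_apply sum.inter_filter[OF finite_\<T>] indicator_def intro!: sum.cong)
    ultimately show meas: "(\<lambda>x. \<omega> x vs) \<in> borel_measurable lebesgue"
      by (simp add: measurable_completion)
    \<comment> \<open>Finitely many continuous functions on compact cells have a common bound; with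
      finite measure of the closure of \<open>\<Omega>\<close> this gives square
      integrability.\<close>
    have "bounded (\<Union>T\<in>\<T>. (\<lambda>x. \<eta> T x vs) ` T)"
      using finite_\<T> compact_cell forms_continuous_on[OF \<eta>]
      by (intro bounded_UN ballI compact_imp_bounded compact_continuous_image) auto
    then obtain M where M: "\<And>T x. T \<in> \<T> \<Longrightarrow> x \<in> T \<Longrightarrow> \<bar>\<eta> T x vs\<bar> \<le> M" "M > 0"
      unfolding bounded_pos by force
    have "\<bar>\<omega> x vs\<bar> \<le> M" for x
    proof (cases "x \<in> \<Omega> \<and> (\<exists>T\<in>\<T>. x \<in> interior T)")
      case True
      then show ?thesis
        using \<omega>_cell M(1) interior_subset by (metis subsetD)
    next
      case False
      then show ?thesis
        using \<omega>_zero[of x] M(2) by (auto simp: \<omega>_def)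
    qed
    then have "(\<omega> x vs)\<^sup>2 \<le> M\<^sup>2" for x
      using M(2) by (metis abs_ge_zero power2_abs power_mono)
    moreover have "compact (closure \<Omega>)"
      using triangulates compact_cell finite_\<T> by (metis compact_Union triangulates_def)
    then have "closure \<Omega> \<in> lmeasurable"
      by (rule lmeasurable_compact)
    ultimately show "integrable lebesgue (\<lambda>x. (\<omega> x vs)\<^sup>2)"
      using meas closure_subset[of \<Omega>]
      by (intro integrableI_bounded_set[where A = "closure \<Omega>" and B = "M\<^sup>2"])
        (auto simp: fmeasurable_def \<omega>_def)
  qed
  ultimately show ?thesis
    unfolding L2_forms_def by (intro image_eqI[of _ _ \<omega>]) (auto simp: \<omega>_def)
qed

section \<open>Global forms as single-valued families\<close>

text \<open>Collects the conditions in \<open>global_space\<close> that concern only the local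
  pieces and not the class modulo null sets.\<close>

definition single_valued :: "('a set \<Rightarrow> 'a form) \<Rightarrow> bool"
  where "single_valued \<eta> \<longleftrightarrow> (\<forall>T\<in>\<T>. \<eta> T \<in> X T) \<and>
    (\<forall>f\<in>F. \<forall>T\<in>\<T>. \<forall>T'\<in>\<T>. f \<subseteq> T \<and> f \<subseteq> T' \<longrightarrow> tr f (\<eta> T) = tr f (\<eta> T'))"

lemma global_space_iff:
  "W \<in> global_space k \<Omega> \<T> X \<longleftrightarrow>
    W \<in> L2_forms k \<Omega> \<and> (\<exists>\<eta>. single_valued \<eta> \<and> (\<forall>T\<in>\<T>. restricts_to W T (\<eta> T)))"
  by (simp only: global_space_def single_valued_def mem_Collect_eq ball_conj_distrib conj_ac)

text \<open>Almost every point of \<open>\<Omega>\<close> is interior to exactly one cell, so a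
  class is recovered from its restrictions. Conversely, \<open>piecewise_L2\<close> supplies the
  square integrability.\<close>

lemma global_space_eq: "global_space k \<Omega> \<T> X = piecewise \<T> ` {\<eta>. single_valued \<eta>}"
proof (intro set_eqI iffI)
  fix W
  assume "W \<in> global_space k \<Omega> \<T> X"
  then obtain \<eta> where \<eta>: "single_valued \<eta>" "\<And>T. T \<in> \<T> \<Longrightarrow> restricts_to W T (\<eta> T)"
    and "W \<in> L2_forms k \<Omega>"
    unfolding global_space_iff by blast
  obtain \<omega> where W: "W = abs_aeform \<omega>" and zero: "\<And>x. x \<notin> \<Omega> \<Longrightarrow> \<omega> x = 0"
    using \<open>W \<in> L2_forms k \<Omega>\<close> unfolding L2_forms_def by (elim imageE CollectE conjE) blast
  have "AE x in lebesgue. \<forall>T\<in>\<T>. x \<in> T \<longrightarrow> \<omega> x = \<eta> T x"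
    using \<eta>(2) by (simp add: W restricts_to.abs_eq AE_ball_countable finite_\<T> countable_finite)
  then have "AE x in lebesgue. \<omega> x = (\<Sum>T | T \<in> \<T> \<and> x \<in> interior T. \<eta> T x)"
    using AE_cell_interior AE_domain
  proof eventually_elim
    case (elim x)
    show ?case
    proof (cases "x \<in> \<Omega>")
      case True
      then obtain T where "T \<in> \<T>" "x \<in> T"
        using cells_cover by blast
      then show ?thesis
        using elim sum_cells_eq[of T x \<eta>] by simp
    next
      case False
      then have "{T \<in> \<T>. x \<in> interior T} = {}"
        using elim(3) cell_subset_closure interior_subset by blast
      then show ?thesis
        using zero[OF False] by (simp del: Collect_empty_eq)
    qed
  qed
  then have "W = piecewise \<T> \<eta>"
    by (simp add: W piecewise_def aeform.abs_eq_iff ae_eq_def)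
  then show "W \<in> piecewise \<T> ` {\<eta>. single_valued \<eta>}"
    using \<eta>(1) by blast
next
  fix W
  assume "W \<in> piecewise \<T> ` {\<eta>. single_valued \<eta>}"
  then obtain \<eta> where \<eta>: "single_valued \<eta>" "W = piecewise \<T> \<eta>"
    by blast
  have "restricts_to W T (\<eta> T)" if "T \<in> \<T>" for T
    unfolding \<eta>(2) piecewise_def restricts_to.abs_eq using AE_cell_interior
    by eventually_elim (use that sum_cells_eq[of T _ \<eta>] in auto)
  moreover have "W \<in> L2_forms k \<Omega>"
    unfolding \<eta>(2) using \<eta>(1) X_forms by (intro piecewise_L2) (auto simp: single_valued_def)
  ultimately show "W \<in> global_space k \<Omega> \<T> X"
    using \<eta>(1) unfolding global_space_iff by blast
qed

text \<open>Local pieces are continuous up to the boundary, so they are determined by the class they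
  define.\<close>

lemma piecewise_eq_zero:
  assumes \<eta>: "\<And>T. T \<in> \<T> \<Longrightarrow> \<eta> T \<in> forms k T" and "piecewise \<T> \<eta> = 0" and T: "T \<in> \<T>"
  shows "\<eta> T = 0"
proof (intro ext)
  fix x vs
  have zero: "AE x in lebesgue. (\<Sum>T | T \<in> \<T> \<and> x \<in> interior T. \<eta> T x) = 0"
    using assms(2) by (simp add: piecewise_def zero_aeform_def aeform.abs_eq_iff ae_eq_def)
  have "AE x in lebesgue. x \<in> interior T \<longrightarrow> \<eta> T x vs = 0"
    using zero by eventually_elim (use sum_cells_eq[OF T, of _ \<eta>] in auto)
  then have "\<eta> T x vs = 0" if "x \<in> T"
    using that convex_cell[OF T] interior_cell[OF T] compact_cell[OF T] forms_continuous_on[OF \<eta>[OF T]]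
    by (intro continuous_AE_zero_imp_zero[of T "\<lambda>x. \<eta> T x vs"]) (auto simp: compact_imp_closed)
  then show "\<eta> T x vs = 0 x vs"
    using \<eta>[OF T] by (cases "x \<in> T") (auto simp: forms_def)
qed

text \<open>The trace on a common face \<open>f\<close> is \<open>assemble \<mu> f\<close> from
  either cell.\<close>

lemma single_valued_assemble:
  assumes "\<And>f. f \<in> F \<Longrightarrow> \<mu> f \<in> X\<^sub>0 f"
  shows "single_valued (assemble \<mu>)"
  using assms assemble_mem[of _ \<mu>] tr_assemble[of _ _ \<mu>] cell_in_all_faces face_space_cell
  unfolding single_valued_def by metis

lemma ex_assemble_single_valued:
  assumes \<eta>: "single_valued \<eta>"
  shows "\<exists>\<mu>. (\<forall>f\<in>F. \<mu> f \<in> X\<^sub>0 f) \<and> (\<forall>T\<in>\<T>. assemble \<mu> T = \<eta> T)"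
proof -
  \<comment> \<open>An arbitrary cell containing \<open>f\<close>; single-valuedness makes
    \<open>\<tau> f\<close> independent of the choice, as \<open>\<tau>_eq\<close> records.\<close>
  define cell where "cell f = (SOME T. T \<in> \<T> \<and> f \<subseteq> T)" for f
  define \<tau> where "\<tau> f = tr f (\<eta> (cell f))" for f
  have cell: "cell f \<in> \<T>" "f \<subseteq> cell f" if "f \<in> F" for f
  proof -
    have "\<exists>T. T \<in> \<T> \<and> f \<subseteq> T"
      using all_faces_cell[OF that] face_of_imp_subset by blast
    then show "cell f \<in> \<T>" "f \<subseteq> cell f"
      unfolding cell_def by (metis (mono_tags, lifting) someI_ex)+
  qed
  have \<tau>_eq: "\<tau> f = tr f (\<eta> T)" if "f \<in> F" "T \<in> \<T>" "f \<subseteq> T" for f T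
    using \<eta> cell[OF that(1)] that unfolding \<tau>_def single_valued_def by blast
  have "\<exists>\<mu>. \<forall>f\<in>F. \<mu> f \<in> X\<^sub>0 f \<and> assemble \<mu> f = \<tau> f"
  proof (rule ex_assemble)
    show "\<tau> f \<in> X\<^sub>F f" if "f \<in> F" for f
      using face_space_eq[OF that cell[OF that]] \<eta> cell[OF that] by (auto simp: \<tau>_def single_valued_def)
    show "tr e (\<tau> f) = \<tau> e" if "e \<in> F" "f \<in> F" "e \<subseteq> f" for e f
    proof -
      have "\<tau> e = tr e (\<eta> (cell f))"
        using that cell[OF that(2)] by (intro \<tau>_eq) auto
      then show ?thesis
        using that(3) by (simp add: \<tau>_def tr_tr)
    qed
  qed
  then obtain \<mu> where \<mu>: "\<And>f. f \<in> F \<Longrightarrow> \<mu> f \<in> X\<^sub>0 f" "\<And>f. f \<in> F \<Longrightarrow> assemble \<mu> f = \<tau> f"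
    by blast
  have "assemble \<mu> T = \<eta> T" if T: "T \<in> \<T>" for T
  proof -
    have "\<eta> T \<in> forms k T"
      using \<eta> T X_forms by (auto simp: single_valued_def)
    then show ?thesis
      using \<mu>(2) \<tau>_eq[of T T] T cell_in_all_faces tr_forms by simp
  qed
  then show ?thesis
    using \<mu>(1) by blast
qed

text \<open>The zero branch of \<open>extend\<close> filters the sum over all faces down to those
  contained in \<open>T\<close>, which is \<open>assemble \<mu> T\<close>.\<close>

lemma sum_extend: "(\<Sum>f\<in>F. extend \<T> E f (\<mu> f)) = piecewise \<T> (assemble \<mu>)"
proof -
  have "(\<Sum>f\<in>F. extend \<T> E f (\<mu> f)) = piecewise \<T> (\<Sum>f\<in>F. (\<lambda>T. if f \<subseteq> T then E f T (\<mu> f) else 0))"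
    by (simp add: extend_def linear_sum[OF linear_piecewise])
  also have "(\<Sum>f\<in>F. (\<lambda>T. if f \<subseteq> T then E f T (\<mu> f) else 0)) = assemble \<mu>"
    by (rule ext) (simp add: assemble_def sum.inter_filter[OF finite_all_faces] sum_fun_apply)
  finally show ?thesis .
qed

section \<open>The direct sum\<close>

lemma lin_on_extend:
  assumes "f \<in> F"
  shows "lin_on (X\<^sub>F f) (extend \<T> E f)"
proof -
  have E: "lin_on (X\<^sub>F f) (E f T)" if "T \<in> \<T>" "f \<subseteq> T" for T
    using that assms lin_on_E cell_in_all_faces by blast
  show ?thesis
    unfolding lin_on_def extend_def
      linear_add[OF linear_piecewise, symmetric] linear_cmul[OF linear_piecewise, symmetric]
    using E by (auto simp: lin_on_def scaleR_fun_def[of _ "_ :: 'a set \<Rightarrow> _"] intro!: piecewise_cong)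
qed

text \<open>Linearity of the extension is known only on \<open>X\<^sub>F f\<close>, so the closure
  properties of the image are checked directly.\<close>

lemma subspace_extend:
  assumes "f \<in> F"
  shows "subspace (extend \<T> E f ` X\<^sub>0 f)"
proof -
  have L: "lin_on (X\<^sub>0 f) (extend \<T> E f)"
    using lin_on_extend[OF assms] face_space0_subset unfolding lin_on_def by blast
  note S = subspace_face_space0[OF assms]
  show ?thesis
  proof (rule subspaceI)
    show "0 \<in> extend \<T> E f ` X\<^sub>0 f"
      using lin_on_zero[OF L S] subspace_0[OF S] by (metis image_eqI)
  next
    fix u v assume "u \<in> extend \<T> E f ` X\<^sub>0 f" "v \<in> extend \<T> E f ` X\<^sub>0 f"
    then obtain \<mu> \<nu> where "\<mu> \<in> X\<^sub>0 f" "\<nu> \<in> X\<^sub>0 f" "u = extend \<T> E f \<mu>" "v = extend \<T> E f \<nu>"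
      by blast
    moreover from this have "extend \<T> E f (\<mu> + \<nu>) = u + v"
      using L by (simp add: lin_on_def)
    ultimately show "u + v \<in> extend \<T> E f ` X\<^sub>0 f"
      using subspace_add[OF S] by (metis image_eqI)
  next
    fix c u assume "u \<in> extend \<T> E f ` X\<^sub>0 f"
    then obtain \<mu> where "\<mu> \<in> X\<^sub>0 f" "u = extend \<T> E f \<mu>"
      by blast
    moreover from this have "extend \<T> E f (c *\<^sub>R \<mu>) = c *\<^sub>R u"
      using L by (simp add: lin_on_def)
    ultimately show "c *\<^sub>R u \<in> extend \<T> E f ` X\<^sub>0 f"
      using subspace_scale[OF S] by (metis image_eqI)
  qed
qed

theorem direct_sum_extend:
  "direct_sum_of (global_space k \<Omega> \<T> X) F (\<lambda>f. extend \<T> E f ` X\<^sub>0 f)"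
  unfolding direct_sum_of_def
proof (intro conjI ballI allI impI)
  show "subspace (extend \<T> E f ` X\<^sub>0 f)" if "f \<in> F" for f
    using that by (rule subspace_extend)
next
  \<comment> \<open>Preimages are chosen for all summands at once; both the inclusion of the sum and
    uniqueness need them.\<close>
  have lift: "\<exists>\<mu>. \<forall>f\<in>F. \<mu> f \<in> X\<^sub>0 f \<and> w f = extend \<T> E f (\<mu> f)"
    if "\<forall>f\<in>F. w f \<in> extend \<T> E f ` X\<^sub>0 f" for w
    using that by (intro bchoice) blast
  show "global_space k \<Omega> \<T> X = {\<Sum>f\<in>F. w f | w. \<forall>f\<in>F. w f \<in> extend \<T> E f ` X\<^sub>0 f}"
  proof (intro set_eqI iffI)
    fix W
    assume "W \<in> global_space k \<Omega> \<T> X"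
    then obtain \<eta> where "single_valued \<eta>" "W = piecewise \<T> \<eta>"
      unfolding global_space_eq by blast
    then obtain \<mu> where \<mu>: "\<And>f. f \<in> F \<Longrightarrow> \<mu> f \<in> X\<^sub>0 f" and "W = piecewise \<T> (assemble \<mu>)"
      using ex_assemble_single_valued piecewise_cong by metis
    then have "W = (\<Sum>f\<in>F. extend \<T> E f (\<mu> f))"
      by (simp add: sum_extend)
    then show "W \<in> {\<Sum>f\<in>F. w f | w. \<forall>f\<in>F. w f \<in> extend \<T> E f ` X\<^sub>0 f}"
      using \<mu> by blast
  next
    fix W
    assume "W \<in> {\<Sum>f\<in>F. w f | w. \<forall>f\<in>F. w f \<in> extend \<T> E f ` X\<^sub>0 f}"
    then obtain w where w: "\<forall>f\<in>F. w f \<in> extend \<T> E f ` X\<^sub>0 f" "W = (\<Sum>f\<in>F. w f)"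
      by blast
    obtain \<mu> where \<mu>: "\<forall>f\<in>F. \<mu> f \<in> X\<^sub>0 f \<and> w f = extend \<T> E f (\<mu> f)"
      using lift[OF w(1)] by blast
    then have "W = piecewise \<T> (assemble \<mu>)"
      by (simp add: w(2) flip: sum_extend)
    then show "W \<in> global_space k \<Omega> \<T> X"
      unfolding global_space_eq using single_valued_assemble \<mu> by blast
  qed
  \<comment> \<open>Uniqueness: a zero class has zero pieces on the cells, hence zero traces on all
    faces, and the triangular system then forces each component to vanish.\<close>
  fix w f
  assume w: "(\<forall>f\<in>F. w f \<in> extend \<T> E f ` X\<^sub>0 f) \<and> (\<Sum>f\<in>F. w f) = 0" and f: "f \<in> F"
  obtain \<mu> where \<mu>: "\<forall>f\<in>F. \<mu> f \<in> X\<^sub>0 f \<and> w f = extend \<T> E f (\<mu> f)"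
    using lift w by blast
  then have "piecewise \<T> (assemble \<mu>) = 0"
    using w by (simp flip: sum_extend)
  moreover have "assemble \<mu> T \<in> forms k T" if "T \<in> \<T>" for T
    using single_valued_assemble[of \<mu>] \<mu> X_forms that by (auto simp: single_valued_def)
  ultimately have zero: "assemble \<mu> T = 0" if "T \<in> \<T>" for T
    using piecewise_eq_zero that by blast
  have "assemble \<mu> g = 0" if g: "g \<in> F" for g
  proof -
    obtain T where T: "T \<in> \<T>" "g \<subseteq> T"
      using all_faces_cell[OF g] face_of_imp_subset by blast
    then have "assemble \<mu> g = tr g (assemble \<mu> T)"
      using tr_assemble[OF g, of T \<mu>] cell_in_all_faces \<mu> by simp
    then show ?thesis
      by (simp add: zero[OF T(1)] linear_0[OF linear_tr])
  qed
  then have "\<mu> f = 0"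
    using assemble_eq_zero[of \<mu> f] \<mu> f by blast
  then have "w f = extend \<T> E f 0"
    using \<mu> f by simp
  then show "w f = 0"
    using lin_on_zero[OF lin_on_extend subspace_face_space] f by simp
qed

end

theorem theorem4p3:
  fixes \<Omega> :: "'a::euclidean_space set"
    and \<T> :: "'a set set"
    and k :: nat
    and X :: "'a set \<Rightarrow> 'a form set"
    and E :: "'a set \<Rightarrow> 'a set \<Rightarrow> 'a form \<Rightarrow> 'a form"
  assumes "polyhedral_domain \<Omega>" and "bounded \<Omega>"
    and "triangulates \<T> \<Omega>"
    and "k \<le> DIM('a)"
    and "\<And>T. T \<in> \<T> \<Longrightarrow> X T \<subseteq> forms k T \<and> finite_dim_subspace (X T)"
    and "trace_compatible \<T> X"
    and "extension_family \<T> X E"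
    and "consistent_family \<T> X E"
  shows "direct_sum_of (global_space k \<Omega> \<T> X) (all_faces \<T>)
           (\<lambda>f. extend \<T> E f ` face_space0 \<T> X f)"
proof -
  interpret extension_setting \<Omega> \<T> k X E
    by standard (use assms in \<open>auto simp: finite_dim_subspace_def\<close>)
  show ?thesis
    by (rule direct_sum_extend)
qed

end
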